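(* Let $q$ be odd and let $G$ be a $q$-manifold (a finite abstract simplicial complex, in the sense defined in the context) with vertex set $V$. Let $g:V\to\{-1,1\}$ be a random function distributed according to the Bayes measure $P$, and let $H=G_g$ be the resulting random submanifold of $G$. Then $$\mathrm{E}[\chi(H)] = 2-2K(G).$$
   Context: A finite abstract simplicial complex $G$ is a finite set of non-empty finite sets closed under taking non-empty subsets. For $x\in G$, $\dim(x)=|x|-1$. Its vertex set is $V=\bigcup_{x\in G}x$. Write $f_k(G)$ for the number of $x\in G$ with $\dim(x)=k$. For $x\in G$, the star is $U(x)=\{y\in G: x\subset y\}$, the closure $\overline{A}$ of $A\subset G$ is the smallest simplicial complex containing $A$, and the unit sphere is $S(x)=\overline{U(x)}\setminus U(x)$. Contractible (inductively): the one-point complex is contractible; $G$ is contractible if there is $x\in G$ such that both $S(x)$ and $G\setminus U(x)$ are contractible. Manifolds and spheres (inductively): the empty complex is the $(-1)$-sphere. For $q\ge 0$, $G$ is a $q$-manifold if for every $x\in G$ the unit sphere $S(x)$ is a $(q-1)$-sphere. A $q$-manifold is a $q$-sphere if there is $x\in G$ such that $G\setminus U(x)$ is contractible. Curvature functional: if $G$ has maximal dimension $q$, $K(G)=1-\frac{f_0(G)}{2}+\frac{f_1(G)}{3}-\cdots=1+\sum_{k=0}^q(-1)^{k+1}\frac{f_k(G)}{k+2}$. Level surface: for $g:V\to\{-1,1\}$, $G_g=\{x\in G : g(x)=\{-1,1\}\}$, i.e. the set of simplices of $G$ on which $g$ takes both values. It is regarded as a delta set in which a $k$-simplex $x$ of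 $G$ has dimension $k-1$ (so the edges of $G$ lying in $G_g$ are its points). Accordingly $\chi(G_g)=\sum_{x\in G_g}(-1)^{\dim(x)-1}$, with $\chi(\emptyset)=0$. (For a $q$-manifold $G$, $G_g$ is called a submanifold because it is either empty or its Barycentric refinement, the complex of non-empty chains of $G_g$ under inclusion, is a $(q-1)$-manifold.) Empty $G_g$ are included in the average. Bayes measure: with $n=|V|$, $P$ is the probability measure on $\{-1,1\}^V$ obtained by choosing $p$ uniformly in $[0,1]$ and then, given $p$, letting the values $g(v)$, $v\in V$, be independent with value $1$ with probability $p$ and $-1$ with probability $1-p$. Equivalently, $P(\{g\})=\frac{1}{(n+1)\binom{n}{m}}$ if $g$ takes the value $1$ exactly $m$ times. $\mathrm{E}$ denotes expectation with respect to $P$. *)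

theory Defs
  imports "HOL-Probability.Probability"
begin

definition abstract_complex :: "'a set set \<Rightarrow> bool" where
  "abstract_complex G \<longleftrightarrow>
     finite G \<and> (\<forall>x\<in>G. finite x \<and> x \<noteq> {}) \<and> (\<forall>x\<in>G. \<forall>y. y \<subseteq> x \<and> y \<noteq> {} \<longrightarrow> y \<in> G)"

definition face_dim :: "'a set \<Rightarrow> int" where
  "face_dim x = int (card x) - 1"

definition face_count :: "'a set set \<Rightarrow> nat \<Rightarrow> nat" where
  "face_count G k = card {x \<in> G. face_dim x = int k}"

definition complex_dim :: "'a set set \<Rightarrow> int" where
  "complex_dim G = (if G = {} then -1 else Max (face_dim ` G))"

definition open_star :: "'a set set \<Rightarrow> 'a set \<Rightarrow> 'a set set" where
  "open_star G x = {y \<in> G. x \<subseteq> y}"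

definition complex_closure :: "'a set set \<Rightarrow> 'a set set" where
  "complex_closure A = \<Inter> {K. abstract_complex K \<and> A \<subseteq> K}"

lemma complex_closure_eq:
  assumes "finite A" and "\<And>x. x \<in> A \<Longrightarrow> finite x \<and> x \<noteq> {}"
  shows "complex_closure A = {y. y \<noteq> {} \<and> (\<exists>x\<in>A. y \<subseteq> x)}" (is "_ = ?C")
proof
  have "finite (\<Union>x\<in>A. Pow x)"
    using assms by auto
  then have "finite ?C"
    by (rule rev_finite_subset) auto
  moreover have "finite y" if "y \<in> ?C" for y
    using that assms(2) finite_subset by blast
  ultimately have "abstract_complex ?C"
    unfolding abstract_complex_def by blast
  moreover have "A \<subseteq> ?C"
    using assms(2) by blast
  ultimately show "complex_closure A \<subseteq> ?C"
    unfolding complex_closure_def by (intro Inter_lower) simp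
  show "?C \<subseteq> complex_closure A"
    unfolding complex_closure_def abstract_complex_def by blast
qed

definition unit_sphere :: "'a set set \<Rightarrow> 'a set \<Rightarrow> 'a set set" where
  "unit_sphere G x = complex_closure (open_star G x) - open_star G x"

inductive contractible_complex :: "'a set set \<Rightarrow> bool" where
  point: "contractible_complex {{v}}"
| step: "abstract_complex G \<Longrightarrow> x \<in> G \<Longrightarrow> contractible_complex (unit_sphere G x) \<Longrightarrow>
    contractible_complex (G - open_star G x) \<Longrightarrow> contractible_complex G"

inductive complex_manifold :: "int \<Rightarrow> 'a set set \<Rightarrow> bool"
  and complex_sphere :: "int \<Rightarrow> 'a set set \<Rightarrow> bool" where
  empty_sphere: "complex_sphere (-1) {}"
| manifold: "q \<ge> 0 \<Longrightarrow> abstract_complex G \<Longrightarrow>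
    (\<And>x. x \<in> G \<Longrightarrow> complex_sphere (q - 1) (unit_sphere G x)) \<Longrightarrow> complex_manifold q G"
| sphere: "complex_manifold q G \<Longrightarrow> x \<in> G \<Longrightarrow>
    contractible_complex (G - open_star G x) \<Longrightarrow> complex_sphere q G"

definition curvature :: "'a set set \<Rightarrow> real" where
  "curvature G =
     1 + (\<Sum>k | int k \<le> complex_dim G. (-1) ^ (k + 1) * real (face_count G k) / (real k + 2))"

definition level_surface :: "'a set set \<Rightarrow> ('a \<Rightarrow> int) \<Rightarrow> 'a set set" where
  "level_surface G g = {x \<in> G. g ` x = {-1, 1}}"

(* A k-simplex of G that belongs to H counts as a (k - 1)-dimensional cell of the delta set H. *)
definition level_euler_char :: "'a set set \<Rightarrow> real" where
  "level_euler_char H = (\<Sum>x\<in>H. (-1) powi (face_dim x - 1))"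

(* Functions are total, so a function V -> {-1,1} is represented by its extension with the value
   undefined outside V. *)
definition signs_pmf :: "'a set \<Rightarrow> real \<Rightarrow> ('a \<Rightarrow> int) pmf" where
  "signs_pmf V p = Pi_pmf V undefined (\<lambda>_. map_pmf (\<lambda>b. if b then 1 else -1) (bernoulli_pmf p))"

definition bayes_measure :: "'a set \<Rightarrow> ('a \<Rightarrow> int) measure" where
  "bayes_measure V = uniform_measure lborel {0..1} \<bind> (\<lambda>p. measure_pmf (signs_pmf V p))"

lemma set_signs_pmf:
  assumes "finite V"
  shows "set_pmf (signs_pmf V p) \<subseteq> PiE_dflt V undefined (\<lambda>_. {-1, 1})"
  unfolding signs_pmf_def by (subst set_Pi_pmf[OF assms]) (auto simp: PiE_dflt_def)

lemma pmf_signs_pmf: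
  assumes "finite V" and "g \<in> PiE_dflt V undefined (\<lambda>_. {-1, 1})" and "p \<in> {0..1}"
  shows "pmf (signs_pmf V p) g =
    p ^ card {v\<in>V. g v = 1} * (1 - p) ^ (card V - card {v\<in>V. g v = 1})"
proof -
  have one: "pmf (map_pmf (\<lambda>b. if b then 1 else - 1) (bernoulli_pmf p)) (1::int) = p"
    using assms(3) pmf_map_inj'[of "\<lambda>b. if b then 1 else - 1 :: int" "bernoulli_pmf p" True]
    by (auto simp: inj_def)
  have minus: "pmf (map_pmf (\<lambda>b. if b then 1 else - 1) (bernoulli_pmf p)) (-1::int) = 1 - p"
    using assms(3) pmf_map_inj'[of "\<lambda>b. if b then 1 else - 1 :: int" "bernoulli_pmf p" False]
    by (auto simp: inj_def)
  have eq: "V - {v\<in>V. g v = 1} = {v\<in>V. g v \<noteq> 1}"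
    by auto
  have "pmf (signs_pmf V p) g = (\<Prod>v\<in>V. if g v = 1 then p else 1 - p)"
    unfolding signs_pmf_def using assms(1,2)
    by (subst pmf_Pi') (auto simp: PiE_dflt_def one minus intro!: prod.cong, metis minus)
  also have "\<dots> = p ^ card {v\<in>V. g v = 1} * (1 - p) ^ card {v\<in>V. g v \<noteq> 1}"
    using assms(1) by (subst prod.If_cases) (auto simp: Int_def Collect_neg_eq[symmetric])
  also have "card {v\<in>V. g v \<noteq> 1} = card V - card {v\<in>V. g v = 1}"
    using card_Diff_subset[of "{v\<in>V. g v = 1}" V] assms(1) eq by auto
  finally show ?thesis .
qed

lemma borel_measurable_pmf_signs_pmf:
  assumes "finite V" and "g \<in> PiE_dflt V undefined (\<lambda>_. {-1, 1})"
  shows "(\<lambda>p. pmf (signs_pmf V p) g) \<in> borel_measurable borel"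
proof -
  have "pmf (map_pmf (\<lambda>b. if b then 1 else - 1) (bernoulli_pmf p)) (g v) =
      (if g v = 1 then min 1 (max 0 p) else 1 - min 1 (max 0 p))" if "v \<in> V" for v p
  proof -
    have "g v = 1 \<or> g v = -1"
      using assms(2) \<open>v \<in> V\<close> by (auto simp: PiE_dflt_def)
    then show ?thesis
      using pmf_map_inj'[of "\<lambda>b. if b then 1 else - 1 :: int" "bernoulli_pmf p" True]
        pmf_map_inj'[of "\<lambda>b. if b then 1 else - 1 :: int" "bernoulli_pmf p" False]
      by (auto simp: inj_def bernoulli_pmf.rep_eq)
  qed
  then have "pmf (signs_pmf V p) g =
      (\<Prod>v\<in>V. if g v = 1 then min 1 (max 0 p) else 1 - min 1 (max 0 p))" for p
    unfolding signs_pmf_def using assms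
    by (subst pmf_Pi') (auto simp: PiE_dflt_def intro!: prod.cong)
  then show ?thesis
    by simp
qed

lemma measurable_signs_pmf:
  assumes "finite V"
  shows "(\<lambda>p. measure_pmf (signs_pmf V p)) \<in>
    uniform_measure lborel {0..1} \<rightarrow>\<^sub>M subprob_algebra (count_space UNIV)"
proof (rule measurable_subprob_algebra)
  show "subprob_space (measure_pmf (signs_pmf V p))" for p
    by (rule subprob_space_measure_pmf)
  show "sets (measure_pmf (signs_pmf V p)) = sets (count_space UNIV)" for p
    by simp
next
  fix A :: "('a \<Rightarrow> int) set"
  let ?S = "PiE_dflt V undefined (\<lambda>_. {-1, 1::int})"
  have fin: "finite ?S"
    using assms by (intro finite_PiE_dflt) auto
  have "emeasure (measure_pmf (signs_pmf V p)) A = (\<Sum>g\<in>A \<inter> ?S. ennreal (pmf (signs_pmf V p) g))" for p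
  proof -
    have "emeasure (measure_pmf (signs_pmf V p)) A = emeasure (measure_pmf (signs_pmf V p)) (A \<inter> ?S)"
      using set_signs_pmf[OF assms, of p]
      by (intro emeasure_eq_AE) (auto simp: AE_measure_pmf_iff)
    also have "\<dots> = (\<Sum>g\<in>A \<inter> ?S. emeasure (measure_pmf (signs_pmf V p)) {g})"
      using fin by (subst emeasure_eq_sum_singleton) auto
    finally show ?thesis
      by (simp add: emeasure_pmf_single)
  qed
  then show "(\<lambda>p. emeasure (measure_pmf (signs_pmf V p)) A) \<in>
      borel_measurable (uniform_measure lborel {0..1})"
    using borel_measurable_pmf_signs_pmf[OF assms] by auto
qed

lemma prob_space_uniform_01: "prob_space (uniform_measure lborel {0..1::real})"
  by (rule prob_space_uniform_measure) auto

lemma prob_space_bayes_measure: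
  assumes "finite V"
  shows "prob_space (bayes_measure V)"
proof -
  interpret prob_space "uniform_measure lborel {0..1::real}"
    by (rule prob_space_uniform_01)
  show ?thesis
    unfolding bayes_measure_def
    by (rule prob_space_bind[OF _ measurable_signs_pmf[OF assms]])
      (simp add: measure_pmf.prob_space_axioms)
qed

lemma measure_bayes_measure_singleton:
  fixes V :: "'a set"
  assumes "finite V" and "g \<in> PiE_dflt V undefined (\<lambda>_. {-1, 1})"
  defines "n \<equiv> card V" and "m \<equiv> card {v\<in>V. g v = 1}"
  shows "measure (bayes_measure V) {g} = 1 / ((real n + 1) * real (n choose m))"
proof -
  interpret prob_space "uniform_measure lborel {0..1::real}"
    by (rule prob_space_uniform_01)
  have "m \<le> n"
    unfolding m_def n_def using assms(1) by (intro card_mono) auto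
  have "measure (bayes_measure V) {g} =
      (\<integral>p. measure (measure_pmf (signs_pmf V p)) {g} \<partial>uniform_measure lborel {0..1})"
    unfolding bayes_measure_def
    by (rule measure_bind[OF measurable_signs_pmf[OF assms(1)]]) simp
  also have "\<dots> = (\<integral>p. indicator {0..1} p * pmf (signs_pmf V p) g \<partial>lborel)"
  proof -
    have "uniform_measure lborel {0..1::real} = density lborel (\<lambda>p. ennreal (indicator {0..1} p))"
      by (auto simp: uniform_measure_def indicator_def intro!: density_cong)
    then show ?thesis
      using borel_measurable_pmf_signs_pmf[OF assms(1,2)]
      by (simp add: integral_density measure_pmf_single)
  qed
  also have "\<dots> = (LBINT p:{0..1}. p ^ m * (1 - p) ^ (n - m))"
    unfolding set_lebesgue_integral_def
    by (intro Bochner_Integration.integral_cong)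
      (auto simp: indicator_def pmf_signs_pmf[OF assms(1,2)] m_def n_def)
  also have "\<dots> = integral {0..1} (\<lambda>p. p ^ m * (1 - p) ^ (n - m))"
    by (intro set_borel_integral_eq_integral borel_integrable_atLeastAtMost') (auto intro!: continuous_intros)
  also have "\<dots> = Beta (real (Suc m)) (real (Suc (n - m)))"
  proof (rule integral_unique, rule has_integral_spike)
    show "negligible {0, 1::real}"
      by simp
    show "((\<lambda>p. p powr real m * (1 - p) powr real (n - m)) has_integral
        Beta (real (Suc m)) (real (Suc (n - m)))) {0..1}"
      using has_integral_Beta_real[of "real (Suc m)" "real (Suc (n - m))"] by simp
    show "p ^ m * (1 - p) ^ (n - m) = p powr real m * (1 - p) powr real (n - m)"
      if "p \<in> {0..1} - {0, 1}" for p :: real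
      using that powr_realpow[of p m] powr_realpow[of "1 - p" "n - m"] by auto
  qed
  also have "\<dots> = fact m * fact (n - m) / fact (Suc n)"
    using \<open>m \<le> n\<close> Gamma_fact[of m, where 'a = real] Gamma_fact[of "n - m", where 'a = real]
      Gamma_fact[of "Suc n", where 'a = real]
    by (simp add: Beta_def of_nat_diff add_ac)
  also have "\<dots> = 1 / ((real n + 1) * real (n choose m))"
    using \<open>m \<le> n\<close> by (simp add: binomial_fact field_simps)
  finally show ?thesis .
qed

end

theory Submission
  imports Defs
begin

text \<open>
  Conditionally on \<open>p\<close>, a simplex with \<open>k \<ge> 1\<close> vertices misses the level surface exactly when \<open>g\<close> is
  constant on it, which has probability \<open>p ^ k + (1 - p) ^ k\<close>; integrating over \<open>p\<close>, the simplex lies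
  in the level surface with probability \<open>1 - 2 / (k + 1)\<close>. By linearity of expectation the expected
  Euler characteristic of the level surface of any complex \<open>G\<close> is \<open>2 - 2 K(G) - \<chi>(G)\<close>
  (lemma \<open>expectation_level_euler_char\<close>).

  What remains is that an odd-dimensional manifold has \<open>\<chi>(G) = 0\<close>. The closure of the star \<open>U(x)\<close> is a
  cone, so \<open>\<chi>(U(x)) = 1 - \<chi>(S(x))\<close>. Removing stars one after the other, this gives \<open>\<chi> = 1\<close> for contractible
  complexes and \<open>\<chi> = 1 + (-1)^q\<close> for \<open>q\<close>-spheres. In a manifold of odd dimension every unit sphere
  therefore has \<open>\<chi>(S(x)) = 2\<close>, hence every star has \<open>\<chi>(U(x)) = -1\<close>. On the other hand, in every complex
  the stars, weighted by the signs \<open>(-1)^dim(x)\<close>, have total Euler characteristic \<open>\<chi>(G)\<close>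
  (lemma \<open>sum_euler_char_open_star\<close>). Comparing the two, \<open>\<chi>(G) = -\<chi>(G)\<close>.
\<close>

section \<open>Euler characteristic of families of simplices\<close>

text \<open>Stars and differences of complexes are not complexes, so the Euler characteristic is taken of
  arbitrary families; it is additive over disjoint unions.\<close>
definition euler_char :: "'a set set \<Rightarrow> real" where
  "euler_char A = (\<Sum>x\<in>A. (-1) ^ Suc (card x))"

lemma euler_char_empty [simp]: "euler_char {} = 0"
  by (simp add: euler_char_def)

lemma euler_char_Diff:
  assumes "finite A" and "B \<subseteq> A"
  shows "euler_char (A - B) = euler_char A - euler_char B"
  using assms by (simp add: euler_char_def sum_diff)

text \<open>Toggling membership of \<open>v\<close> pairs off members of opposite parity.\<close>
lemma sum_alternating_toggle_closed:
  assumes "finite B" and "\<And>y. y \<in> B \<Longrightarrow> finite y"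
    and ins: "\<And>y. y \<in> B \<Longrightarrow> insert v y \<in> B" and del: "\<And>y. y \<in> B \<Longrightarrow> y - {v} \<in> B"
  shows "(\<Sum>y\<in>B. (-1::real) ^ Suc (card y)) = 0"
proof -
  let ?B0 = "{y \<in> B. v \<notin> y}"
  have "inj_on (insert v) ?B0"
    by (auto simp: inj_on_def)
  have "y \<in> insert v ` ?B0" if "y \<in> B" "v \<in> y" for y
    using del[OF that(1)] that by (intro image_eqI[of _ _ "y - {v}"]) auto
  then have B: "B = ?B0 \<union> insert v ` ?B0"
    using ins by blast
  have "(\<Sum>y\<in>B. (-1::real) ^ Suc (card y)) =
      (\<Sum>y\<in>?B0. (-1) ^ Suc (card y)) + (\<Sum>y\<in>insert v ` ?B0. (-1) ^ Suc (card y))"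
    using assms(1) by (subst B, subst sum.union_disjoint) auto
  also have "(\<Sum>y\<in>insert v ` ?B0. (-1::real) ^ Suc (card y)) = (\<Sum>y\<in>?B0. (-1) ^ card y)"
    using assms(2) by (subst sum.reindex[OF \<open>inj_on _ _\<close>]) (auto intro!: sum.cong)
  finally show ?thesis
    by (simp add: sum_negf)
qed

text \<open>With the empty simplex added, the family is closed under toggling \<open>v\<close>; the empty simplex
  itself accounts for the value 1.\<close>
lemma euler_char_cone:
  assumes "finite B" and "\<And>y. y \<in> B \<Longrightarrow> finite y" and "{} \<in> B"
    and "\<And>y. y \<in> B \<Longrightarrow> insert v y \<in> B" and "\<And>y. y \<in> B \<Longrightarrow> y - {v} \<in> B"
  shows "euler_char (B - {{}}) = 1"
  using sum_alternating_toggle_closed[OF assms(1,2,4,5)] assms(1,3)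
  by (simp add: euler_char_def sum_diff)

section \<open>Stars and unit spheres\<close>

lemma abstract_complex_finite: "abstract_complex G \<Longrightarrow> finite G"
  and abstract_complex_finite_face: "abstract_complex G \<Longrightarrow> x \<in> G \<Longrightarrow> finite x"
  and abstract_complex_nonempty_face: "abstract_complex G \<Longrightarrow> x \<in> G \<Longrightarrow> x \<noteq> {}"
  and abstract_complex_face: "abstract_complex G \<Longrightarrow> x \<in> G \<Longrightarrow> y \<subseteq> x \<Longrightarrow> y \<noteq> {} \<Longrightarrow> y \<in> G"
  unfolding abstract_complex_def by blast+

lemma open_star_subset: "open_star G x \<subseteq> G"
  by (auto simp: open_star_def)

lemma complex_closure_open_star:
  assumes G: "abstract_complex G"
  shows "complex_closure (open_star G x) = {y. y \<union> x \<in> G} - {{}}"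
proof -
  have "complex_closure (open_star G x) = {y. y \<noteq> {} \<and> (\<exists>z\<in>open_star G x. y \<subseteq> z)}"
  proof (rule complex_closure_eq)
    show "finite (open_star G x)"
      using open_star_subset abstract_complex_finite[OF G] by (rule finite_subset)
    show "finite y \<and> y \<noteq> {}" if "y \<in> open_star G x" for y
      using that G open_star_subset abstract_complex_finite_face abstract_complex_nonempty_face
      by blast
  qed
  also have "\<dots> = {y. y \<union> x \<in> G} - {{}}"
  proof (intro set_eqI iffI)
    fix y
    assume "y \<in> {y. y \<noteq> {} \<and> (\<exists>z\<in>open_star G x. y \<subseteq> z)}"
    then obtain z where "y \<noteq> {}" "z \<in> G" "x \<subseteq> z" "y \<subseteq> z"
      by (auto simp: open_star_def)
    then show "y \<in> {y. y \<union> x \<in> G} - {{}}"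
      using abstract_complex_face[OF G \<open>z \<in> G\<close>, of "y \<union> x"] by auto
  next
    fix y
    assume "y \<in> {y. y \<union> x \<in> G} - {{}}"
    then show "y \<in> {y. y \<noteq> {} \<and> (\<exists>z\<in>open_star G x. y \<subseteq> z)}"
      by (auto simp: open_star_def intro!: bexI[of _ "y \<union> x"])
  qed
  finally show ?thesis .
qed

text \<open>The closed star is a cone whose apex may be any vertex of \<open>x\<close>.\<close>
lemma euler_char_open_star:
  assumes G: "abstract_complex G" and x: "x \<in> G"
  shows "euler_char (open_star G x) = 1 - euler_char (unit_sphere G x)"
proof -
  let ?B = "{y. y \<union> x \<in> G}"
  obtain v where v: "v \<in> x"
    using abstract_complex_nonempty_face[OF G x] by auto
  have sub: "?B \<subseteq> Pow (\<Union>G)"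
    by blast
  have "finite (\<Union>G)"
    using G by (auto simp: abstract_complex_def)
  then have fin: "finite ?B"
    using finite_subset[OF sub] by simp
  have "euler_char (?B - {{}}) = 1"
  proof (rule euler_char_cone[OF fin])
    show "finite y" if "y \<in> ?B" for y
      using that sub \<open>finite (\<Union>G)\<close> finite_subset by blast
    show "{} \<in> ?B"
      using x by simp
    show "insert v y \<in> ?B" if "y \<in> ?B" for y
      using that v by (simp add: insert_absorb)
    show "y - {v} \<in> ?B" if "y \<in> ?B" for y
    proof -
      have "y - {v} \<union> x = y \<union> x"
        using v by auto
      then show ?thesis
        using that by simp
    qed
  qed
  moreover have "open_star G x \<subseteq> ?B - {{}}"
    using abstract_complex_nonempty_face[OF G]
    by (auto simp: open_star_def sup.absorb1)
  then have "euler_char (unit_sphere G x) = euler_char (?B - {{}}) - euler_char (open_star G x)"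
    using fin unfolding unit_sphere_def complex_closure_open_star[OF G]
    by (intro euler_char_Diff) simp_all
  ultimately show ?thesis
    by simp
qed

lemma euler_char_remove_open_star:
  assumes "abstract_complex G" and "x \<in> G"
  shows "euler_char G = euler_char (G - open_star G x) + 1 - euler_char (unit_sphere G x)"
  using euler_char_Diff[OF abstract_complex_finite[OF assms(1)] open_star_subset, of x]
    euler_char_open_star[OF assms] by linarith

text \<open>Exchange the order of summation over pairs \<open>x \<subseteq> y\<close>: every simplex \<open>y\<close> is weighted by the
  Euler characteristic of the complex of its faces, which is 1.\<close>
lemma sum_euler_char_open_star:
  assumes G: "abstract_complex G"
  shows "(\<Sum>x\<in>G. (-1) ^ Suc (card x) * euler_char (open_star G x)) = euler_char G"
proof -
  have faces: "euler_char {x \<in> G. x \<subseteq> y} = 1" if y: "y \<in> G" for y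
  proof -
    obtain v where v: "v \<in> y"
      using abstract_complex_nonempty_face[OF G y] by auto
    have fin: "finite y"
      by (rule abstract_complex_finite_face[OF G y])
    have "{x \<in> G. x \<subseteq> y} = Pow y - {{}}"
      using abstract_complex_nonempty_face[OF G] abstract_complex_face[OF G y] by blast
    moreover have "euler_char (Pow y - {{}}) = 1"
      using fin v by (intro euler_char_cone[of _ v]) (auto intro: finite_subset)
    ultimately show ?thesis
      by simp
  qed
  have "(\<Sum>x\<in>G. (-1) ^ Suc (card x) * euler_char (open_star G x)) =
      (\<Sum>x\<in>G. \<Sum>y | y \<in> G \<and> x \<subseteq> y. (-1) ^ Suc (card y) * (-1) ^ Suc (card x))"
    by (simp add: euler_char_def open_star_def sum_distrib_left mult.commute)
  also have "\<dots> = (\<Sum>y\<in>G. \<Sum>x | x \<in> G \<and> x \<subseteq> y. (-1) ^ Suc (card y) * (-1) ^ Suc (card x))"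
    using abstract_complex_finite[OF G] by (intro sum.swap_restrict) auto
  also have "\<dots> = (\<Sum>y\<in>G. (-1) ^ Suc (card y) * euler_char {x \<in> G. x \<subseteq> y})"
    by (simp only: euler_char_def sum_distrib_left)
  also have "\<dots> = euler_char G"
    using faces by (simp add: euler_char_def)
  finally show ?thesis .
qed

section \<open>Spheres and odd-dimensional manifolds\<close>

lemma euler_char_contractible: "contractible_complex G \<Longrightarrow> euler_char G = 1"
proof (induction rule: contractible_complex.induct)
  case (point v)
  show ?case
    by (simp add: euler_char_def)
next
  case (step G x)
  then show ?case
    using euler_char_remove_open_star[of G x] by simp
qed

lemma complex_manifold_abstract_complex: "complex_manifold q G \<Longrightarrow> abstract_complex G"
  by (erule complex_manifold.cases) simp

text \<open>Both statements go together along the mutual definition: a sphere is a contractible complex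
  with one star added, so its value is \<open>1 + (1 - \<chi>(S(x)))\<close> with \<open>S(x)\<close> a sphere of one dimension less.\<close>
lemma euler_char_unit_sphere_manifold:
    "complex_manifold q G \<Longrightarrow> \<forall>x\<in>G. euler_char (unit_sphere G x) = (if odd q then 2 else 0)"
  and euler_char_sphere: "complex_sphere q G \<Longrightarrow> euler_char G = (if even q then 2 else 0)"
proof (induction rule: complex_manifold_complex_sphere.inducts)
  case empty_sphere
  show ?case
    by simp
next
  case (manifold q G)
  then show ?case
    by auto
next
  case (sphere q G x)
  then show ?case
    using euler_char_remove_open_star[of G x] complex_manifold_abstract_complex[of q G]
      euler_char_contractible[of "G - open_star G x"]
    by auto
qed

text \<open>All stars have Euler characteristic -1, so their signed total is both \<open>\<chi>(G)\<close> and \<open>-\<chi>(G)\<close>.\<close>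
lemma euler_char_odd_manifold:
  assumes "odd q" and "complex_manifold q G"
  shows "euler_char G = 0"
proof -
  have G: "abstract_complex G"
    using assms(2) by (rule complex_manifold_abstract_complex)
  have "euler_char (open_star G x) = -1" if "x \<in> G" for x
    using euler_char_unit_sphere_manifold[OF assms(2)] euler_char_open_star[OF G that] assms(1) that
    by simp
  then have "(\<Sum>x\<in>G. (-1) ^ Suc (card x) * euler_char (open_star G x)) = - euler_char G"
    by (simp add: euler_char_def sum_negf)
  then show ?thesis
    using sum_euler_char_open_star[OF G] by simp
qed

section \<open>Expectation under the Bayes measure\<close>

lemma measure_signs_pmf_constant:
  assumes "finite V" and "x \<subseteq> V" and "p \<in> {0..1}"
  shows "measure (signs_pmf V p) {g. \<forall>v\<in>x. g v = 1} = p ^ card x"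
    and "measure (signs_pmf V p) {g. \<forall>v\<in>x. g v = -1} = (1 - p) ^ card x"
proof -
  let ?coin = "map_pmf (\<lambda>b. if b then 1 else - 1 :: int) (bernoulli_pmf p)"
  have *: "measure (signs_pmf V p) {g. \<forall>v\<in>x. g v = c} = pmf ?coin c ^ card x" for c
  proof -
    have "{g. \<forall>v\<in>x. g v = c} = Pi V (\<lambda>v. if v \<in> x then {c} else UNIV)"
      using assms(2) by (auto simp: Pi_def split: if_splits)
    then have "measure (signs_pmf V p) {g. \<forall>v\<in>x. g v = c} =
        (\<Prod>v\<in>V. measure ?coin (if v \<in> x then {c} else UNIV))"
      unfolding signs_pmf_def using assms(1) by (simp add: measure_Pi_pmf_Pi)
    also have "\<dots> = (\<Prod>v\<in>V. if v \<in> x then pmf ?coin c else 1)"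
      by (intro prod.cong) (simp_all add: measure_pmf_single del: measure_map_pmf)
    also have "\<dots> = (\<Prod>v\<in>V \<inter> x. pmf ?coin c)"
      using assms(1) by (rule prod.inter_restrict[symmetric])
    also have "\<dots> = pmf ?coin c ^ card x"
      using assms(2) by (simp add: Int_absorb1)
    finally show ?thesis .
  qed
  have "pmf ?coin 1 = p" and "pmf ?coin (-1) = 1 - p"
    using assms(3) pmf_map_inj'[of "\<lambda>b. if b then 1 else - 1 :: int" "bernoulli_pmf p" True]
      pmf_map_inj'[of "\<lambda>b. if b then 1 else - 1 :: int" "bernoulli_pmf p" False]
    by (auto simp: inj_def)
  then show "measure (signs_pmf V p) {g. \<forall>v\<in>x. g v = 1} = p ^ card x"
    and "measure (signs_pmf V p) {g. \<forall>v\<in>x. g v = -1} = (1 - p) ^ card x"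
    by (simp_all add: *)
qed

text \<open>The probabilities of the two constant cases only add up because \<open>x\<close> is nonempty; on the empty
  set they coincide.\<close>
lemma measure_signs_pmf_both_values:
  assumes "finite V" and "x \<subseteq> V" and "x \<noteq> {}" and "p \<in> {0..1}"
  shows "measure (signs_pmf V p) {g. g ` x = {-1, 1}} = 1 - p ^ card x - (1 - p) ^ card x"
proof -
  let ?M = "measure_pmf (signs_pmf V p)"
  let ?E = "{g. g ` x = {-1, 1::int}}" and ?P = "{g. \<forall>v\<in>x. g v = (1::int)}"
    and ?N = "{g. \<forall>v\<in>x. g v = (-1::int)}"
  have const: "(\<forall>v\<in>x. g v = c) \<longleftrightarrow> g ` x = {c}" for g :: "'a \<Rightarrow> int" and c
    using assms(3) by (auto simp: image_def)
  have disj: "?E \<inter> ?P = {}" "(?E \<union> ?P) \<inter> ?N = {}"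
    unfolding const by auto
  have "g \<in> ?E \<union> ?P \<union> ?N" if "g \<in> set_pmf (signs_pmf V p)" for g
  proof -
    have "g v \<in> {-1, 1}" if "v \<in> V" for v
      using set_signs_pmf[OF assms(1), of p] \<open>g \<in> set_pmf _\<close> that unfolding PiE_dflt_def by blast
    then have "g ` x \<subseteq> {-1, 1}"
      using assms(2) by blast
    moreover have "I = {-1, 1} \<or> I = {1} \<or> I = {-1}" if "I \<subseteq> {-1, 1}" and "I \<noteq> {}" for I :: "int set"
      using that by (cases "1 \<in> I"; cases "-1 \<in> I") blast+
    ultimately have "g ` x = {-1, 1} \<or> g ` x = {1} \<or> g ` x = {-1}"
      using assms(3) by simp
    then show ?thesis
      unfolding const by simp
  qed
  then have "1 = measure ?M (?E \<union> ?P \<union> ?N)"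
    using measure_pmf.prob_eq_1[of "?E \<union> ?P \<union> ?N" "signs_pmf V p"] by (simp add: AE_measure_pmf_iff)
  also have "\<dots> = measure ?M (?E \<union> ?P) + measure ?M ?N"
    by (rule measure_pmf.finite_measure_Union[OF _ _ disj(2)]) simp_all
  also have "measure ?M (?E \<union> ?P) = measure ?M ?E + measure ?M ?P"
    by (rule measure_pmf.finite_measure_Union[OF _ _ disj(1)]) simp_all
  finally show ?thesis
    using measure_signs_pmf_constant[OF assms(1,2,4)] by simp
qed

lemma sets_bayes_measure: "sets (bayes_measure V) = UNIV"
proof -
  have "sets (bayes_measure V) = sets (count_space UNIV)"
    unfolding bayes_measure_def by (rule sets_bind) simp_all
  then show ?thesis
    by simp
qed

lemma measure_bayes_measure_both_values:
  assumes "finite V" and "x \<subseteq> V" and "x \<noteq> {}"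
  shows "measure (bayes_measure V) {g. g ` x = {-1, 1}} = 1 - 2 / (real (card x) + 1)"
proof -
  interpret prob_space "uniform_measure lborel {0..1::real}"
    by (rule prob_space_uniform_01)
  let ?E = "{g. g ` x = {-1, 1::int}}"
  let ?f = "\<lambda>p::real. 1 - p ^ card x - (1 - p) ^ card x"
  have "measure (bayes_measure V) ?E =
      (\<integral>p. measure (signs_pmf V p) ?E \<partial>uniform_measure lborel {0..1})"
    unfolding bayes_measure_def
    by (rule measure_bind[OF measurable_signs_pmf[OF assms(1)]]) simp
  also have "\<dots> = (\<integral>p. ?f p \<partial>uniform_measure lborel {0..1})"
  proof (rule integral_cong_AE)
    show "(\<lambda>p. measure (signs_pmf V p) ?E) \<in> borel_measurable (uniform_measure lborel {0..1})"
      using measurable_signs_pmf[OF assms(1)]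
      by (rule measurable_compose) (rule measurable_measure_subprob_algebra, simp)
    show "AE p in uniform_measure lborel {0..1}. measure (signs_pmf V p) ?E = ?f p"
      using measure_signs_pmf_both_values[OF assms] by (intro AE_uniform_measureI) auto
  qed simp
  also have "\<dots> = (LBINT p:{0..1}. ?f p)"
  proof -
    have "uniform_measure lborel {0..1::real} = density lborel (\<lambda>p. ennreal (indicator {0..1} p))"
      by (auto simp: uniform_measure_def indicator_def intro!: density_cong)
    then show ?thesis
      by (simp add: integral_density set_lebesgue_integral_def)
  qed
  also have "\<dots> = integral {0..1} ?f"
    by (intro set_borel_integral_eq_integral borel_integrable_atLeastAtMost')
      (auto intro!: continuous_intros)
  also have "\<dots> = 1 - 2 / (real (card x) + 1)"
  proof -
    let ?k = "card x"
    let ?F = "\<lambda>p::real. p - p ^ Suc ?k / (real ?k + 1) + (1 - p) ^ Suc ?k / (real ?k + 1)"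
    have deriv: "(?F has_real_derivative ?f p) (at p within {0..1})" for p
      by (rule derivative_eq_intros refl | simp add: add.commute)+
    have "(?f has_integral (?F 1 - ?F 0)) {0..1}"
      by (rule fundamental_theorem_of_calculus)
        (simp_all only: zero_le_one deriv flip: has_real_derivative_iff_has_vector_derivative)
    then have "integral {0..1} ?f = ?F 1 - ?F 0"
      by (rule integral_unique)
    also have "\<dots> = 1 - 2 / (real ?k + 1)"
      by simp
    finally show ?thesis .
  qed
  finally show ?thesis .
qed

lemma curvature_eq_sum_faces:
  assumes G: "abstract_complex G"
  shows "curvature G = 1 + (\<Sum>x\<in>G. (-1) ^ card x / (real (card x) + 1))"
proof -
  let ?K = "{k. int k \<le> complex_dim G}"
  let ?h = "\<lambda>x. (-1::real) ^ card x / (real (card x) + 1)"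
  have finG: "finite G"
    by (rule abstract_complex_finite[OF G])
  have "?K \<subseteq> {..nat (complex_dim G)}"
    by auto
  then have finK: "finite ?K"
    by (rule finite_subset) simp
  have pos: "card x > 0" if "x \<in> G" for x
    using that G by (auto simp: abstract_complex_def card_gt_0_iff)
  have "card x - 1 \<in> ?K" if "x \<in> G" for x
  proof -
    have "face_dim x \<le> complex_dim G"
      using that finG by (auto simp: complex_dim_def)
    then show ?thesis
      using pos[OF that] by (simp add: face_dim_def of_nat_diff)
  qed
  then have "(\<Sum>x\<in>G. ?h x) = (\<Sum>k\<in>?K. \<Sum>x | x \<in> G \<and> card x - 1 = k. ?h x)"
    using finG finK by (intro sum.group[symmetric]) auto
  also have "\<dots> = (\<Sum>k\<in>?K. (-1) ^ (k + 1) * real (face_count G k) / (real k + 2))"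
  proof (rule sum.cong[OF refl])
    fix k
    have card_iff: "card x - 1 = k \<longleftrightarrow> card x = Suc k" if "x \<in> G" for x
      using pos[OF that] by auto
    have "face_dim x = int k \<longleftrightarrow> card x = Suc k" for x :: "'a set"
      unfolding face_dim_def by linarith
    then have "{x \<in> G. card x - 1 = k} = {x \<in> G. face_dim x = int k}"
      using card_iff by blast
    moreover have "(\<Sum>x | x \<in> G \<and> card x - 1 = k. ?h x) =
        (\<Sum>x | x \<in> G \<and> card x - 1 = k. (-1) ^ (k + 1) / (real k + 2))"
    proof (intro sum.cong refl)
      fix x
      assume "x \<in> {x \<in> G. card x - 1 = k}"
      then have "card x = Suc k"
        using card_iff by blast
      then show "?h x = (-1) ^ (k + 1) / (real k + 2)"
        by (simp add: add.commute)
    qed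
    ultimately show "(\<Sum>x | x \<in> G \<and> card x - 1 = k. ?h x) =
        (-1) ^ (k + 1) * real (face_count G k) / (real k + 2)"
      by (simp add: face_count_def)
  qed
  finally show ?thesis
    by (simp add: curvature_def)
qed

text \<open>The coefficient \<open>1 - 2 / (card x + 1)\<close> splits the expectation into \<open>-\<chi>(G)\<close>, with the sign
  from the dimension shift, and twice the alternating sum that defines the curvature.\<close>
theorem expectation_level_euler_char:
  assumes G: "abstract_complex G"
  shows "(\<integral>g. level_euler_char (level_surface G g) \<partial>bayes_measure (\<Union>G)) =
    2 - 2 * curvature G - euler_char G"
proof -
  let ?M = "bayes_measure (\<Union>G)"
  have fin: "finite (\<Union>G)" and finG: "finite G"
    using G by (auto simp: abstract_complex_def)
  interpret prob_space ?M
    by (rule prob_space_bayes_measure[OF fin])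
  have space: "space ?M = UNIV"
    using sets_bayes_measure sets.sets_into_space[of UNIV ?M] by auto
  let ?E = "\<lambda>x. {g. g ` x = {-1, 1::int}}"
  (* The dimension shift of the delta set turns the sign of x into (-1) ^ (card x - 2). *)
  have "level_euler_char (level_surface G g) = (\<Sum>x\<in>G. (-1) ^ card x * indicator (?E x) g)" for g
  proof -
    have "(-1::real) powi (face_dim x - 1) = (-1) ^ card x" for x :: "'a set"
    proof -
      have "face_dim x - 1 = int (card x) - 2"
        by (simp add: face_dim_def)
      moreover have "(-1::real) powi (int (card x) - 2) = (-1) powi int (card x) / (-1) powi 2"
        by (rule power_int_diff) simp
      ultimately show ?thesis
        by (simp only: power_int_of_nat) simp
    qed
    then have "level_euler_char (level_surface G g) = (\<Sum>x | x \<in> G \<and> g ` x = {-1, 1}. (-1) ^ card x)"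
      by (simp add: level_euler_char_def level_surface_def)
    also have "\<dots> = (\<Sum>x\<in>G. if g ` x = {-1, 1} then (-1) ^ card x else 0)"
      using finG by (rule sum.inter_filter)
    also have "\<dots> = (\<Sum>x\<in>G. (-1) ^ card x * indicator (?E x) g)"
      by (intro sum.cong) (simp_all add: indicator_def)
    finally show ?thesis .
  qed
  then have "(\<integral>g. level_euler_char (level_surface G g) \<partial>?M) =
      (\<Sum>x\<in>G. \<integral>g. (-1) ^ card x * indicator (?E x) g \<partial>?M)"
    using sets_bayes_measure
    by (simp only:, intro Bochner_Integration.integral_sum)
      (auto intro!: integrable_mult_right integrable_real_indicator simp: emeasure_eq_measure)
  also have "\<dots> = (\<Sum>x\<in>G. (-1) ^ card x * measure ?M (?E x))"
    by (simp add: space)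
  also have "\<dots> = (\<Sum>x\<in>G. (-1) ^ card x * (1 - 2 / (real (card x) + 1)))"
    using measure_bayes_measure_both_values[OF fin] abstract_complex_nonempty_face[OF G]
    by (intro sum.cong) (auto simp: Sup_upper)
  also have "\<dots> = (\<Sum>x\<in>G. (-1) ^ card x) - 2 * (\<Sum>x\<in>G. (-1) ^ card x / (real (card x) + 1))"
    by (simp add: right_diff_distrib sum_subtractf sum_distrib_left mult.commute)
  also have "\<dots> = 2 - 2 * curvature G - euler_char G"
    unfolding curvature_eq_sum_faces[OF G] by (simp add: euler_char_def sum_negf)
  finally show ?thesis .
qed

theorem theorem2:
  fixes G :: "'a set set" and q :: int
  assumes "odd q" and "complex_manifold q G"
  shows "(\<integral>g. level_euler_char (level_surface G g) \<partial>bayes_measure (\<Union>G)) = 2 - 2 * curvature G"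
  using expectation_level_euler_char[OF complex_manifold_abstract_complex[OF assms(2)]]
    euler_char_odd_manifold[OF assms] by simp

end
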